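(* As formal power series in $\mathbb{Z}[[p,q]]$, \[ \sum_{n, \ell \ge 0} (F_{0,n}(j), F_{0,\ell}(j))\, p^{n}q^{\ell} = \frac{\psi (p,q) - \psi (q,p)}{j(p)^{-1} - j(q)^{-1}}, \qquad \psi (p,q) = \frac{E_{2}(p) E_{6}(q)}{j(p) E_{4}(q)}. \]
   Context: For a variable $x$, $E_2(x)=1-24\sum_{n\ge1}\sigma_1(n)x^n$, $E_4(x)=1+240\sum\sigma_3(n)x^n$, $E_6(x)=1-504\sum\sigma_5(n)x^n$, $\Delta(x)=(E_4(x)^3-E_6(x)^2)/1728$, $j(x)=E_4(x)^3/\Delta(x)=x^{-1}+744+\cdots$ (these are the $q$-expansions of the Eisenstein series, discriminant and modular invariant on $SL_2(\mathbb{Z})$). The Atkin inner product on $\mathbb{C}[j]$ is $(f,g)=$ constant term of the Laurent expansion of $f(j(x))g(j(x))E_2(x)$ in $x$. For $n\ge0$, $F_{0,n}(X)$ (the generalized Faber polynomial of weight $0$) is the unique monic polynomial of degree $n$ with $F_{0,n}(j(x))=x^{-n}+O(x)$. *)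

theory Defs
  imports
    Complex_Main
    "HOL-Computational_Algebra.Computational_Algebra"
begin

unbundle Formal_Power_Series.fps_syntax
unbundle Formal_Laurent_Series.fps_syntax

definition sigma :: "nat \<Rightarrow> nat \<Rightarrow> nat" where
  "sigma k n = (\<Sum>d | d dvd n. d ^ k)"

definition Eis2 :: "complex fps" where
  "Eis2 = Abs_fps (\<lambda>n. if n = 0 then 1 else - 24 * of_nat (sigma 1 n))"

definition Eis4 :: "complex fps" where
  "Eis4 = Abs_fps (\<lambda>n. if n = 0 then 1 else 240 * of_nat (sigma 3 n))"

definition Eis6 :: "complex fps" where
  "Eis6 = Abs_fps (\<lambda>n. if n = 0 then 1 else - 504 * of_nat (sigma 5 n))"

definition Delta :: "complex fps" where
  "Delta = (Eis4 ^ 3 - Eis6 ^ 2) / 1728"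

text \<open>
  The invariant \<open>j = E\<^sub>4\<^sup>3 / \<Delta>\<close> is needed in the field of Laurent series in one variable, and,
  in each of the variables \<open>p\<close> and \<open>q\<close>, in the field of fractions of the ring of power series in
  \<open>p\<close>, \<open>q\<close>. The parameter \<open>v\<close> is the ring embedding of one-variable power series into the field
  in question; it plays the role of the variable.
\<close>

definition klein_j :: "(complex fps \<Rightarrow> 'a :: field) \<Rightarrow> 'a" where
  "klein_j v = v Eis4 ^ 3 / v Delta"

abbreviation jx :: "complex fls" where
  "jx \<equiv> klein_j fps_to_fls"

text \<open>The polynomial ring in \<open>j\<close> is represented by \<^typ>\<open>complex poly\<close>.\<close>

definition eval_j :: "complex poly \<Rightarrow> complex fls" where
  "eval_j f = poly (map_poly fls_const f) jx"

definition atkin :: "complex poly \<Rightarrow> complex poly \<Rightarrow> complex" where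
  "atkin f g = (eval_j f * eval_j g * fps_to_fls Eis2) $$ 0"

definition is_faber :: "nat \<Rightarrow> complex poly \<Rightarrow> bool" where
  "is_faber n F \<longleftrightarrow> degree F = n \<and> lead_coeff F = 1 \<and>
     (\<forall>k\<le>0. (eval_j F - fls_X_inv ^ n) $$ k = 0)"

definition faber :: "nat \<Rightarrow> complex poly" where
  "faber n = (THE F. is_faber n F)"

text \<open>
  Power series in \<open>p\<close>, \<open>q\<close> are power series in \<open>p\<close> whose coefficients are power series in \<open>q\<close>:
  the coefficient of \<open>p\<^sup>n q\<^sup>l\<close> of \<open>f\<close> is \<^term>\<open>(f $ n) $ l\<close>.
  For a one-variable series \<open>f\<close>, \<open>in_p f\<close> and \<open>in_q f\<close> are \<open>f(p)\<close> and \<open>f(q)\<close>.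
\<close>

definition in_p :: "complex fps \<Rightarrow> complex fps fps fract" where
  "in_p f = to_fract (Abs_fps (\<lambda>n. fps_const (f $ n)))"

definition in_q :: "complex fps \<Rightarrow> complex fps fps fract" where
  "in_q f = to_fract (fps_const f)"

definition psi ::
    "(complex fps \<Rightarrow> complex fps fps fract) \<Rightarrow> (complex fps \<Rightarrow> complex fps fps fract)
      \<Rightarrow> complex fps fps fract" where
  "psi v w = (v Eis2 * w Eis6) / (klein_j v * w Eis4)"


subsection \<open>Well-definedness\<close>

lemma sigma_1 [simp]: "sigma k (Suc 0) = 1"
  by (simp add: sigma_def)

lemma Eis4_nth_0 [simp]: "Eis4 $ 0 = 1" and Eis6_nth_0 [simp]: "Eis6 $ 0 = 1"
  and Eis4_nth_1 [simp]: "Eis4 $ Suc 0 = 240" and Eis6_nth_1 [simp]: "Eis6 $ Suc 0 = - 504"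
  by (simp_all add: Eis4_def Eis6_def)

lemma Delta_nth: "Delta $ n = (Eis4 ^ 3 - Eis6 ^ 2) $ n / 1728"
proof -
  have "Delta = (Eis4 ^ 3 - Eis6 ^ 2) / fps_const 1728"
    by (simp only: Delta_def numeral_fps_const)
  also have "\<dots> = (Eis4 ^ 3 - Eis6 ^ 2) * fps_const (inverse 1728)"
    by (subst fps_divide_unit) (simp_all add: fps_const_inverse)
  finally have "Delta = (Eis4 ^ 3 - Eis6 ^ 2) * fps_const (inverse 1728)" .
  hence "Delta $ n = ((Eis4 ^ 3 - Eis6 ^ 2) * fps_const (inverse 1728)) $ n" by (rule arg_cong)
  thus ?thesis by (simp only: fps_mult_right_const_nth divide_inverse)
qed

lemma Delta_nth_0 [simp]: "Delta $ 0 = 0" and Delta_nth_1 [simp]: "Delta $ Suc 0 = 1"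
  by (simp_all add: Delta_nth fps_mult_nth power2_eq_square power3_eq_cube)

lemma Eis4_nonzero [simp]: "Eis4 \<noteq> 0"
  using Eis4_nth_0 by fastforce

lemma Delta_nonzero [simp]: "Delta \<noteq> 0"
  using Delta_nth_1 by fastforce

lemma subdegree_Delta [simp]: "subdegree Delta = 1"
  by (rule subdegreeI) simp_all

lemma subdegree_Eis4 [simp]: "subdegree Eis4 = 0"
  by (rule subdegreeI) simp_all

lemma jx_mult_Delta: "jx * fps_to_fls Delta = fps_to_fls (Eis4 ^ 3)"
  by (simp add: klein_j_def fps_to_fls_power)

lemma jx_nonzero [simp]: "jx \<noteq> 0"
  by (simp add: klein_j_def)

lemma subdegree_jx [simp]: "fls_subdegree jx = - 1"
proof -
  have "fls_subdegree (jx * fps_to_fls Delta) = fls_subdegree jx + 1"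
    by (subst fls_subdegree_mult) (simp_all add: fls_subdegree_fls_to_fps)
  moreover have "fls_subdegree (jx * fps_to_fls Delta) = 0"
    by (simp only: jx_mult_Delta) (simp add: fls_subdegree_fls_to_fps)
  ultimately show ?thesis by simp
qed

lemma jx_nth_neg1 [simp]: "jx $$ (- 1) = 1"
proof -
  have "(jx * fps_to_fls Delta) $$ (fls_subdegree jx + fls_subdegree (fps_to_fls Delta))
          = jx $$ (- 1)"
    by (subst fls_times_base) (simp add: fls_subdegree_fls_to_fps)
  moreover have "(jx * fps_to_fls Delta) $$ 0 = 1"
    by (simp only: jx_mult_Delta) (simp add: power3_eq_cube)
  ultimately show ?thesis by (simp add: fls_subdegree_fls_to_fps)
qed

lemma jx_power_nth: "(jx ^ n) $$ (- int n) = 1"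
  using fls_pow_base[of jx n] by simp

lemma jx_power_nth_below: "k < - int n \<Longrightarrow> (jx ^ n) $$ k = 0"
  using fls_pow_nth_below_subdegree[of k n jx] by simp

lemma map_poly_fls_const_add:
  "map_poly fls_const (f + g) = map_poly fls_const f + map_poly fls_const (g :: complex poly)"
  by (rule poly_eqI) (simp add: coeff_map_poly fls_plus_const)

lemma map_poly_fls_const_smult:
  "map_poly fls_const (smult c f) = smult (fls_const c) (map_poly fls_const (f :: complex poly))"
  by (rule poly_eqI) (simp add: coeff_map_poly)

lemma eval_j_add: "eval_j (f + g) = eval_j f + eval_j g"
  by (simp add: eval_j_def map_poly_fls_const_add)

lemma eval_j_smult: "eval_j (smult c f) = fls_const c * eval_j f"
  by (simp add: eval_j_def map_poly_fls_const_smult)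

lemma eval_j_diff: "eval_j (f - g) = eval_j f - eval_j g"
  using eval_j_add[of "f - g" g] by simp

lemma eval_j_monom: "eval_j (monom 1 n) = jx ^ n"
  by (simp add: eval_j_def map_poly_monom poly_monom)

lemma eval_j_altdef: "eval_j f = (\<Sum>i\<le>degree f. fls_const (coeff f i) * jx ^ i)"
  by (simp add: eval_j_def poly_altdef coeff_map_poly degree_map_poly)

lemma eval_j_nth: "eval_j f $$ k = (\<Sum>i\<le>degree f. coeff f i * (jx ^ i) $$ k)"
  by (simp add: eval_j_altdef fls_nth_sum)

lemma eval_j_nth_degree: "eval_j f $$ (- int (degree f)) = lead_coeff f"
proof -
  have "eval_j f $$ (- int (degree f))
          = (\<Sum>i\<in>{degree f}. coeff f i * (jx ^ i) $$ (- int (degree f)))"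
    unfolding eval_j_nth by (rule sum.mono_neutral_right) (auto simp: jx_power_nth_below)
  thus ?thesis by (simp add: jx_power_nth)
qed

lemma eval_j_cancel:
  "\<exists>G. degree G < n + Suc 0 \<and> (\<forall>k\<le>0. - int n \<le> k \<longrightarrow> (h - eval_j G) $$ k = 0)"
proof (induction n arbitrary: h)
  case 0
  show ?case
    by (rule exI[of _ "monom (h $$ 0) 0"])
       (auto simp: eval_j_def map_poly_monom map_poly_pCons poly_monom monom_0)
next
  case (Suc n)
  define c where "c = h $$ (- int (Suc n))"
  define M where "M = smult c (monom 1 (Suc n))"
  obtain G where G: "degree G < n + Suc 0"
    "\<And>k. k \<le> 0 \<Longrightarrow> - int n \<le> k \<Longrightarrow> (h - eval_j M - eval_j G) $$ k = 0"
    using Suc.IH[of "h - eval_j M"] by blast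
  have M: "eval_j M $$ (- int (Suc n)) = c"
    unfolding M_def eval_j_smult eval_j_monom fls_mult_const_nth jx_power_nth by simp
  have "eval_j G $$ (- int (Suc n)) = 0"
    unfolding eval_j_nth using G(1)
    by (intro sum.neutral) (auto simp: jx_power_nth_below)
  hence top: "(h - eval_j M - eval_j G) $$ (- int (Suc n)) = 0"
    using M by (simp add: c_def)
  have "degree (M + G) < Suc n + Suc 0"
  proof -
    have "degree M \<le> Suc n"
      unfolding M_def by (rule order.trans[OF degree_smult_le degree_monom_le])
    hence "degree (M + G) \<le> Suc n" using G(1) by (intro degree_add_le) auto
    thus ?thesis by simp
  qed
  moreover have "(h - eval_j (M + G)) $$ k = 0" if "k \<le> 0" "- int (Suc n) \<le> k" for k
  proof -
    have "(h - eval_j M - eval_j G) $$ k = 0"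
    proof (cases "k = - int (Suc n)")
      case True
      thus ?thesis by (simp only: top)
    next
      case False
      thus ?thesis using that by (intro G(2)) auto
    qed
    thus ?thesis by (simp add: eval_j_add algebra_simps)
  qed
  ultimately show ?case by blast
qed

lemma faber_exists: "\<exists>F. is_faber n F"
proof -
  obtain G where G: "degree G < n + Suc 0"
    "\<And>k. k \<le> 0 \<Longrightarrow> - int n \<le> k \<Longrightarrow> (fls_X_inv ^ n - eval_j G) $$ k = 0"
    using eval_j_cancel[of n "fls_X_inv ^ n"] by blast
  have X: "(fls_X_inv ^ n :: complex fls) $$ k = (if k = - int n then 1 else 0)" for k
    by (simp add: fls_X_inv_power_nth)
  have "eval_j G $$ (- int n) = coeff G n"
  proof -
    have "eval_j G $$ (- int n) = (\<Sum>i\<le>degree G. if i = n then coeff G n else 0)"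
      unfolding eval_j_nth using G(1)
      by (intro sum.cong) (auto simp: jx_power_nth jx_power_nth_below)
    thus ?thesis using G(1) by (auto simp: coeff_eq_0)
  qed
  hence lc: "coeff G n = 1" using G(2)[of "- int n"] X by simp
  hence deg: "degree G = n"
    using G(1) le_degree[of G n] by simp
  have "(eval_j G - fls_X_inv ^ n) $$ k = 0" if "k \<le> 0" for k
  proof (cases "- int n \<le> k")
    case True
    thus ?thesis using G(2)[of k] that by simp
  next
    case False
    hence "eval_j G $$ k = 0"
      unfolding eval_j_nth deg by (intro sum.neutral) (auto simp: jx_power_nth_below)
    thus ?thesis using False X by simp
  qed
  thus ?thesis using lc deg unfolding is_faber_def by blast
qed

lemma faber_unique:
  assumes "is_faber n F" "is_faber n G"
  shows "F = G"
proof -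
  have "eval_j F $$ k = eval_j G $$ k" if "k \<le> 0" for k
  proof -
    have "(eval_j F - fls_X_inv ^ n) $$ k = 0" "(eval_j G - fls_X_inv ^ n) $$ k = 0"
      using assms that unfolding is_faber_def by blast+
    thus ?thesis unfolding fls_minus_nth by (simp only: right_minus_eq)
  qed
  hence "eval_j (F - G) $$ (- int (degree (F - G))) = 0"
    by (simp add: eval_j_diff)
  hence "lead_coeff (F - G) = 0" by (simp only: eval_j_nth_degree)
  hence "F - G = 0" by (simp only: leading_coeff_0_iff)
  thus ?thesis by simp
qed

lemma is_faber_faber: "is_faber n (faber n)"
proof -
  obtain F where "is_faber n F" using faber_exists by blast
  moreover from this have "G = F" if "is_faber n G" for G using that by (rule faber_unique[rotated])
  ultimately show ?thesis unfolding faber_def by (rule theI)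
qed

lemma in_p_eq_0_iff [simp]: "in_p f = 0 \<longleftrightarrow> f = 0"
  by (auto simp: in_p_def fps_eq_iff)

lemma in_q_eq_0_iff [simp]: "in_q f = 0 \<longleftrightarrow> f = 0"
  by (simp add: in_q_def)

lemma klein_j_in_p_nonzero: "klein_j in_p \<noteq> 0" and klein_j_in_q_nonzero: "klein_j in_q \<noteq> 0"
  by (simp_all add: klein_j_def)

lemma denominator_nonzero: "inverse (klein_j in_p) - inverse (klein_j in_q) \<noteq> 0"
proof
  let ?P = "\<lambda>f :: complex fps. Abs_fps (\<lambda>n. fps_const (f $ n))"
  assume "inverse (klein_j in_p) - inverse (klein_j in_q) = 0"
  hence "in_p Delta * in_q Eis4 ^ 3 = in_q Delta * in_p Eis4 ^ 3"
    by (simp add: klein_j_def field_simps)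
  hence "?P Delta * fps_const Eis4 ^ 3 = fps_const Delta * ?P Eis4 ^ 3"
    by (simp add: in_p_def in_q_def power3_eq_cube flip: to_fract_mult)
  hence "(?P Delta * fps_const Eis4 ^ 3) $ 0 $ 1 = (fps_const Delta * ?P Eis4 ^ 3) $ 0 $ 1"
    by simp
  thus False by (simp add: power3_eq_cube fps_mult_nth)
qed

end

theory Submission
  imports Defs
begin

text \<open>
  Let \<open>\<theta> = x d/dx\<close> and \<open>j = \<Sum> c\<^sub>m x\<^sup>m\<close>. A polynomial in \<open>j\<close> times \<open>dj\<close> has no residue, so the coefficient
  of \<open>x\<close> in \<open>F\<^sub>n(j)\<close> is \<open>n c\<^sub>n\<close>, and comparing principal parts gives
  \<open>j F\<^sub>n = F\<^sub>n\<^sub>+\<^sub>1 + (\<Sum>m\<le>n. c\<^sub>m F\<^sub>n\<^sub>-\<^sub>m) + n c\<^sub>n\<close>. Since \<open>(F\<^sub>n, 1)\<close> is the coefficient of \<open>x\<^sup>n\<close> in \<open>E\<^sub>2\<close>, the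
  symmetry \<open>(j F\<^sub>n, F\<^sub>l) = (F\<^sub>n, j F\<^sub>l)\<close> says precisely that the generating function \<open>G\<close> satisfies
  \<open>(j(p) - j(q)) G = E\<^sub>2(p) \<theta>j(q) - E\<^sub>2(q) \<theta>j(p)\<close>; it also yields integrality by induction on \<open>n\<close>,
  starting from \<open>(1, F\<^sub>l)\<close>. The only modular input is \<open>\<theta>j = - j E\<^sub>6 / E\<^sub>4\<close>. This follows from
  Ramanujan's formulas for \<open>\<theta>E\<^sub>4\<close> and \<open>\<theta>E\<^sub>6\<close>, that is, from convolution identities for divisor sums,
  which have an elementary proof in the style of Skoruppa.
\<close>

subsection \<open>Convolutions of divisor sums\<close>

text \<open>A solution is a splitting of \<open>n\<close> into \<open>a * x\<close> and
  \<open>b * y\<close> with a marked divisor \<open>a\<close> or \<open>b\<close> of each part, so a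
  convolution of divisor sums is a sum of monomials in \<open>a\<close>, \<open>b\<close> over this
  set.\<close>

definition quads :: "nat \<Rightarrow> (nat \<times> nat \<times> nat \<times> nat) set" where
  "quads n = {(a, b, x, y). 0 < a \<and> 0 < b \<and> 0 < x \<and> 0 < y \<and> a * x + b * y = n}"

lemma finite_quads [simp]: "finite (quads n)"
proof (rule finite_subset)
  show "quads n \<subseteq> {..n} \<times> {..n} \<times> {..n} \<times> {..n}"
  proof
    fix t assume "t \<in> quads n"
    then obtain a b x y where t: "t = (a, b, x, y)" "0 < a" "0 < b" "0 < x" "0 < y" "a * x + b * y = n"
      by (auto simp: quads_def)
    have "a \<le> a * x" "x \<le> a * x" "b \<le> b * y" "y \<le> b * y" using t by auto
    hence "a \<le> n" "x \<le> n" "b \<le> n" "y \<le> n" using t(6) by linarith+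
    thus "t \<in> {..n} \<times> {..n} \<times> {..n} \<times> {..n}" using t(1) by simp
  qed
qed auto

text \<open>
  The map \<open>(a, b, x, y) \<mapsto> (a + b, b, x, y - x)\<close> takes the solutions with \<open>x < y\<close> to those with
  \<open>a > b\<close>. Hence the sums of \<open>h\<close> and \<open>g\<close> differ only on the diagonals \<open>x = y\<close> and \<open>a = b\<close>.
\<close>

lemma sum_quads_shear:
  fixes g h :: "nat \<Rightarrow> nat \<Rightarrow> 'a :: ab_group_add"
  assumes h: "\<And>a b. h a b = h b a" and g: "\<And>a b. g a b = g b a"
    and shear: "\<And>a b. g (a + b) b = h a b"
  shows "(\<Sum>(a, b, x, y) \<in> quads n. h a b - g a b)
    = (\<Sum>(a, b, x, y) \<in> {(a, b, x, y) \<in> quads n. x = y}. h a b)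
      - (\<Sum>(a, b, x, y) \<in> {(a, b, x, y) \<in> quads n. a = b}. g a b)"
proof -
  \<comment> \<open>The parameter \<open>u\<close> selects what is compared: the cofactors
    \<open>x\<close> and \<open>y\<close> in the sum of \<open>h\<close>, the divisors
    \<open>a\<close> and \<open>b\<close> in the sum of \<open>g\<close>.\<close>
  have split: "sum f (quads n) = sum f {(a, b, x, y) \<in> quads n. u a x < u b y}
      + sum f {(a, b, x, y) \<in> quads n. u a x > u b y} + sum f {(a, b, x, y) \<in> quads n. u a x = u b y}"
    for f :: "nat \<times> nat \<times> nat \<times> nat \<Rightarrow> 'a" and u :: "nat \<Rightarrow> nat \<Rightarrow> nat"
  proof -
    have "sum f (quads n) = sum f ({(a, b, x, y) \<in> quads n. u a x < u b y}
      \<union> {(a, b, x, y) \<in> quads n. u a x > u b y} \<union> {(a, b, x, y) \<in> quads n. u a x = u b y})"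
      by (rule arg_cong[of _ _ "sum f"]) auto
    also have "\<dots> = sum f ({(a, b, x, y) \<in> quads n. u a x < u b y}
      \<union> {(a, b, x, y) \<in> quads n. u a x > u b y}) + sum f {(a, b, x, y) \<in> quads n. u a x = u b y}"
      by (rule sum.union_disjoint) (auto intro: finite_subset[OF _ finite_quads])
    also have "sum f ({(a, b, x, y) \<in> quads n. u a x < u b y}
      \<union> {(a, b, x, y) \<in> quads n. u a x > u b y}) = sum f {(a, b, x, y) \<in> quads n. u a x < u b y}
      + sum f {(a, b, x, y) \<in> quads n. u a x > u b y}"
      by (rule sum.union_disjoint) (auto intro: finite_subset[OF _ finite_quads])
    finally show ?thesis .
  qed
  have 1: "(\<Sum>(a, b, x, y) \<in> {(a, b, x, y) \<in> quads n. x < y}. h a b)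
      = (\<Sum>(a, b, x, y) \<in> {(a, b, x, y) \<in> quads n. a > b}. g a b)"
    by (rule sum.reindex_bij_witness[where i = "\<lambda>(a, b, x, y). (a - b, b, x, x + y)"
          and j = "\<lambda>(a, b, x, y). (a + b, b, x, y - x)"])
       (auto simp: quads_def shear[symmetric] algebra_simps dest!: less_imp_Suc_add)
  have 2: "(\<Sum>(a, b, x, y) \<in> {(a, b, x, y) \<in> quads n. x > y}. h a b)
      = (\<Sum>(a, b, x, y) \<in> {(a, b, x, y) \<in> quads n. x < y}. h a b)"
    by (rule sum.reindex_bij_witness[where i = "\<lambda>(a, b, x, y). (b, a, y, x)"
          and j = "\<lambda>(a, b, x, y). (b, a, y, x)"]) (auto simp: quads_def h)
  have 3: "(\<Sum>(a, b, x, y) \<in> {(a, b, x, y) \<in> quads n. a < b}. g a b)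
      = (\<Sum>(a, b, x, y) \<in> {(a, b, x, y) \<in> quads n. a > b}. g a b)"
    by (rule sum.reindex_bij_witness[where i = "\<lambda>(a, b, x, y). (b, a, y, x)"
          and j = "\<lambda>(a, b, x, y). (b, a, y, x)"]) (auto simp: quads_def g)
  have H: "(\<Sum>(a, b, x, y) \<in> quads n. h a b)
    = (\<Sum>(a, b, x, y) \<in> {(a, b, x, y) \<in> quads n. a > b}. g a b)
    + (\<Sum>(a, b, x, y) \<in> {(a, b, x, y) \<in> quads n. a > b}. g a b)
    + (\<Sum>(a, b, x, y) \<in> {(a, b, x, y) \<in> quads n. x = y}. h a b)"
    using split[of "\<lambda>(a, b, x, y). h a b" "\<lambda>a x. x"] by (simp only: 1 2)
  have G: "(\<Sum>(a, b, x, y) \<in> quads n. g a b)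
    = (\<Sum>(a, b, x, y) \<in> {(a, b, x, y) \<in> quads n. a > b}. g a b)
    + (\<Sum>(a, b, x, y) \<in> {(a, b, x, y) \<in> quads n. a > b}. g a b)
    + (\<Sum>(a, b, x, y) \<in> {(a, b, x, y) \<in> quads n. a = b}. g a b)"
    using split[of "\<lambda>(a, b, x, y). g a b" "\<lambda>a x. a"] by (simp only: 3)
  have "(\<Sum>(a, b, x, y) \<in> quads n. h a b - g a b)
    = (\<Sum>(a, b, x, y) \<in> quads n. h a b) - (\<Sum>(a, b, x, y) \<in> quads n. g a b)"
    by (simp add: sum_subtractf case_prod_unfold)
  thus ?thesis unfolding H G by simp
qed

text \<open>If \<open>x = y\<close>, then \<open>(a + b) * x = n\<close>; thus
  \<open>d = a + b\<close> is a divisor of \<open>n\<close>, split into two positive parts.\<close>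

lemma sum_quads_diagonal_cofactors:
  fixes h :: "nat \<Rightarrow> nat \<Rightarrow> 'a :: comm_monoid_add"
  assumes "n > 0"
  shows "(\<Sum>(a, b, x, y) \<in> {(a, b, x, y) \<in> quads n. x = y}. h a b)
    = (\<Sum>d | d dvd n. \<Sum>a = 1..<d. h a (d - a))"
proof -
  have "(\<Sum>d | d dvd n. \<Sum>a = 1..<d. h a (d - a))
      = (\<Sum>(d, a) \<in> (SIGMA d : {d. d dvd n}. {1..<d}). h a (d - a))"
    using assms by (subst sum.Sigma) auto
  also have "\<dots> = (\<Sum>(a, b, x, y) \<in> {(a, b, x, y) \<in> quads n. x = y}. h a b)"
    using assms
    by (intro sum.reindex_bij_witness[where j = "\<lambda>(d, a). (a, d - a, n div d, n div d)"
          and i = "\<lambda>(a, b, x, y). (a + b, a)"])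
       (auto simp: quads_def add_mult_distrib[symmetric] dvd_def)
  finally show ?thesis by simp
qed

text \<open>If \<open>a = b = d\<close>, then \<open>d * (x + y) = n\<close>, which leaves
  \<open>n div d - 1\<close> choices for \<open>x\<close>.\<close>

lemma sum_quads_diagonal:
  fixes g :: "nat \<Rightarrow> nat \<Rightarrow> 'a :: comm_ring_1"
  assumes "n > 0"
  shows "(\<Sum>(a, b, x, y) \<in> {(a, b, x, y) \<in> quads n. a = b}. g a b)
    = (\<Sum>d | d dvd n. of_nat (n div d - 1) * g d d)"
proof -
  have "(\<Sum>d | d dvd n. of_nat (n div d - 1) * g d d)
      = (\<Sum>d | d dvd n. \<Sum>x = 1..<n div d. g d d)"
    by simp
  also have "\<dots> = (\<Sum>(d, x) \<in> (SIGMA d : {d. d dvd n}. {1..<n div d}). g d d)"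
    using assms by (subst sum.Sigma) auto
  also have "\<dots> = (\<Sum>(a, b, x, y) \<in> {(a, b, x, y) \<in> quads n. a = b}. g a b)"
    using assms
    by (intro sum.reindex_bij_witness[where j = "\<lambda>(d, x). (d, d, x, n div d - x)"
          and i = "\<lambda>(a, b, x, y). (a, x)"])
       (auto simp: quads_def add_mult_distrib2[symmetric] dvd_def)
  finally show ?thesis by simp
qed

lemma sum_quads_sigma:
  "(\<Sum>(a, b, x, y) \<in> quads n. of_nat a ^ i * of_nat b ^ j :: complex)
    = (\<Sum>k = 0..n. of_nat (sigma i k) * of_nat (sigma j (n - k)))"
proof -
  have cofactor: "0 < b \<and> b \<le> n - k" if "b dvd n - k" "k < n" for b k
    using that by (auto intro: dvd_imp_le dvd_pos_nat[of "n - k"])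
  \<comment> \<open>The end terms vanish because \<open>sigma i 0 = 0\<close>: every number divides
    0, and a sum over an infinite set is 0 by convention.\<close>
  have "(\<Sum>k = 0..n. of_nat (sigma i k) * of_nat (sigma j (n - k)) :: complex)
    = (\<Sum>k \<in> {0<..<n}. of_nat (sigma i k) * of_nat (sigma j (n - k)))"
    by (rule sum.mono_neutral_right) (auto simp: sigma_def not_less le_less)
  also have "\<dots> = (\<Sum>k \<in> {0<..<n}. \<Sum>(a, b) \<in> {a. a dvd k} \<times> {b. b dvd (n - k)}. of_nat a ^ i * of_nat b ^ j)"
    by (simp add: sigma_def sum_product sum.cartesian_product)
  also have "\<dots> = (\<Sum>(k, a, b) \<in> (SIGMA k : {0<..<n}. {a. a dvd k} \<times> {b. b dvd (n - k)}). of_nat a ^ i * of_nat b ^ j)"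
    by (subst sum.Sigma) auto
  also have "\<dots> = (\<Sum>(a, b, x, y) \<in> quads n. of_nat a ^ i * of_nat b ^ j)"
    by (intro sum.reindex_bij_witness[where j = "\<lambda>(k, a, b). (a, b, k div a, (n - k) div b)"
          and i = "\<lambda>(a, b, x, y). (a * x, a, b)"])
       (auto simp: quads_def div_greater_zero_iff dest: cofactor)
  finally show ?thesis by simp
qed

text \<open>Faulhaber's formulas with the upper limit excluded, which makes the second coefficient
  \<open>- 1 / 2\<close>. They evaluate the sums of \<open>h a (d - a)\<close> over the diagonal
  \<open>x = y\<close>.\<close>

lemma power_sums:
  fixes d :: nat
  shows "(\<Sum>a<d. of_nat a) = (of_nat d ^ 2 / 2 - of_nat d / 2 :: complex)"
    "(\<Sum>a<d. of_nat a ^ 2) = (of_nat d ^ 3 / 3 - of_nat d ^ 2 / 2 + of_nat d / 6 :: complex)"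
    "(\<Sum>a<d. of_nat a ^ 3) = (of_nat d ^ 4 / 4 - of_nat d ^ 3 / 2 + of_nat d ^ 2 / 4 :: complex)"
    "(\<Sum>a<d. of_nat a ^ 4) = (of_nat d ^ 5 / 5 - of_nat d ^ 4 / 2 + of_nat d ^ 3 / 3 - of_nat d / 30 :: complex)"
    "(\<Sum>a<d. of_nat a ^ 5) = (of_nat d ^ 6 / 6 - of_nat d ^ 5 / 2 + 5 * of_nat d ^ 4 / 12 - of_nat d ^ 2 / 12 :: complex)"
    "(\<Sum>a<d. of_nat a ^ 6) = (of_nat d ^ 7 / 7 - of_nat d ^ 6 / 2 + of_nat d ^ 5 / 2 - of_nat d ^ 3 / 6 + of_nat d / 42 :: complex)"
proof (induction d)
  case (Suc d)
  {
    case 1 show ?case by (simp add: Suc field_simps; algebra)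
  next
    case 2 show ?case by (simp add: Suc field_simps; algebra)
  next
    case 3 show ?case by (simp add: Suc field_simps; algebra)
  next
    case 4 show ?case by (simp add: Suc field_simps; algebra)
  next
    case 5 show ?case by (simp add: Suc field_simps; algebra)
  next
    case 6 show ?case by (simp add: Suc field_simps; algebra)
  }
qed simp_all

lemma sum_quads_eq_divisor_sums:
  fixes g h :: "nat \<Rightarrow> nat \<Rightarrow> 'a :: comm_ring_1"
  assumes "n > 0" "\<And>a b. h a b = h b a" "\<And>a b. g a b = g b a" "\<And>a b. g (a + b) b = h a b"
  shows "(\<Sum>(a, b, x, y) \<in> quads n. h a b - g a b)
    = (\<Sum>d | d dvd n. \<Sum>a = 1..<d. h a (d - a))
      - (\<Sum>d | d dvd n. of_nat (n div d - 1) * g d d)"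
  using sum_quads_shear[OF assms(2-4), of n]
  by (simp only: sum_quads_diagonal_cofactors[OF assms(1)] sum_quads_diagonal[OF assms(1)])

text \<open>
  For a symmetric function \<open>F(a\<^sup>2, b\<^sup>2, c\<^sup>2)\<close>, the pair \<open>h(a, b) = F(a\<^sup>2, b\<^sup>2, (a + b)\<^sup>2)\<close>,
  \<open>g(a, b) = h(a, - b)\<close> meets the hypotheses above, and \<open>h - g\<close> keeps only the monomials that are odd in
  both variables. The three choices of \<open>h\<close> are the powers \<open>2, 3\<close> of \<open>a\<^sup>2 + a b + b\<^sup>2\<close> and
  \<open>(a b (a + b))\<^sup>2\<close>.
\<close>

lemma sigma_convolution:
  assumes "n > 0"
  shows sigma_convolution_1_3: "240 * (\<Sum>k = 0..n. of_nat (sigma 1 k) * of_nat (sigma 3 (n - k)))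
      = (21 * of_nat (sigma 5 n) + 10 * of_nat (sigma 3 n) - of_nat (sigma 1 n)
          - 30 * of_nat n * of_nat (sigma 3 n) :: complex)"
    and sigma_convolution_3_3: "120 * (\<Sum>k = 0..n. of_nat (sigma 3 k) * of_nat (sigma 3 (n - k)))
      = (of_nat (sigma 7 n) - of_nat (sigma 3 n) :: complex)"
    and sigma_convolution_1_5: "504 * (\<Sum>k = 0..n. of_nat (sigma 1 k) * of_nat (sigma 5 (n - k)))
      = (20 * of_nat (sigma 7 n) + 21 * of_nat (sigma 5 n) + of_nat (sigma 1 n)
          - 42 * of_nat n * of_nat (sigma 5 n) :: complex)"
proof -
  let ?c = "\<lambda>i j. \<Sum>(a, b, x, y) \<in> quads n. of_nat a ^ i * of_nat b ^ j :: complex"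
  let ?s = "\<lambda>k. of_nat (sigma k n) :: complex"
  have sigma_sum: "(\<Sum>d | d dvd n. of_nat d ^ k) = ?s k" for k
    by (simp add: sigma_def)
  have swap: "?c i j = ?c j i" for i j
    by (rule sum.reindex_bij_witness[where i = "\<lambda>(a, b, x, y). (b, a, y, x)"
          and j = "\<lambda>(a, b, x, y). (b, a, y, x)"]) (auto simp: quads_def)
  have drop0: "(\<Sum>a = 1..<d. f a) = (\<Sum>a<d. f a) - f 0" if "d dvd n" for d and f :: "nat \<Rightarrow> complex"
  proof -
    have "d > 0" using that assms by (auto intro: dvd_pos_nat)
    thus ?thesis by (simp add: lessThan_atLeast0 sum.atLeast_Suc_lessThan)
  qed
  \<comment> \<open>Source of the terms with a factor \<open>n\<close> in the convolutions, which
    later become derivatives of generating series.\<close>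
  have codiv: "of_nat (n div d - 1) * (of_nat d ^ Suc k) = (of_nat n * of_nat d ^ k - of_nat d ^ Suc k :: complex)"
    if "d dvd n" for d k
  proof -
    obtain m where m: "n = d * m" using \<open>d dvd n\<close> by (elim dvdE)
    thus ?thesis using assms by (simp add: of_nat_diff algebra_simps)
  qed
  {
    define h :: "nat \<Rightarrow> nat \<Rightarrow> complex" where "h a b = (of_nat a ^ 2 + of_nat a * of_nat b + of_nat b ^ 2) ^ 2" for a b
    define g :: "nat \<Rightarrow> nat \<Rightarrow> complex" where "g a b = (of_nat a ^ 2 - of_nat a * of_nat b + of_nat b ^ 2) ^ 2" for a b
    have inner: "(\<Sum>a = 1..<d. h a (d - a)) = 7 / 10 * of_nat d ^ 5 - of_nat d ^ 4 + of_nat d ^ 3 / 3 - of_nat d / 30"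
      if "d dvd n" for d
    proof -
      let ?D = "of_nat d :: complex"
      have "(\<Sum>a = 1..<d. h a (d - a)) = (\<Sum>a = 1..<d. ?D ^ 4 - 2 * ?D ^ 3 * of_nat a + 3 * ?D ^ 2 * of_nat a ^ 2
          - 2 * ?D * of_nat a ^ 3 + of_nat a ^ 4)"
        by (intro sum.cong refl) (simp add: h_def of_nat_diff, algebra)
      also have "\<dots> = 7 / 10 * ?D ^ 5 - ?D ^ 4 + ?D ^ 3 / 3 - ?D / 30"
        unfolding drop0[OF that] sum.distrib sum_subtractf
        by (simp add: power_sums flip: sum_distrib_left) (simp add: field_simps; algebra)
      finally show ?thesis .
    qed
    have "(\<Sum>(a, b, x, y) \<in> quads n. h a b - g a b)
        = (\<Sum>(a, b, x, y) \<in> quads n. 4 * (of_nat a ^ 3 * of_nat b ^ 1) + 4 * (of_nat a ^ 1 * of_nat b ^ 3))"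
      by (intro sum.cong refl) (clarsimp simp: h_def g_def, algebra)
    also have "\<dots> = 4 * ?c 3 1 + 4 * ?c 1 3"
      by (simp only: case_prod_unfold sum.distrib sum_distrib_left)
    finally have lhs: "(\<Sum>(a, b, x, y) \<in> quads n. h a b - g a b) = 8 * ?c 1 3"
      using swap[of 1 3] by simp
    have "8 * ?c 1 3 = (\<Sum>d | d dvd n. \<Sum>a = 1..<d. h a (d - a))
        - (\<Sum>d | d dvd n. of_nat (n div d - 1) * g d d)"
      unfolding lhs[symmetric]
    proof (rule sum_quads_eq_divisor_sums[OF assms])
      show "h a b = h b a" "g a b = g b a" "g (a + b) b = h a b" for a b
        by (simp only: h_def g_def of_nat_add, algebra)+
    qed
    also have "(\<Sum>d | d dvd n. of_nat (n div d - 1) * g d d)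
        = (\<Sum>d | d dvd n. of_nat n * of_nat d ^ 3 - of_nat d ^ 4)"
    proof (intro sum.cong refl)
      fix d assume "d \<in> {d. d dvd n}"
      moreover have "g d d = of_nat d ^ Suc 3" by (simp add: g_def power2_eq_square eval_nat_numeral)
      ultimately show "of_nat (n div d - 1) * g d d = of_nat n * of_nat d ^ 3 - of_nat d ^ 4"
        using codiv[of d 3] by simp
    qed
    also have "(\<Sum>d | d dvd n. \<Sum>a = 1..<d. h a (d - a))
       = (\<Sum>d | d dvd n. 7 / 10 * of_nat d ^ 5 - of_nat d ^ 4 + of_nat d ^ 3 / 3 - of_nat d ^ 1 / 30)"
      by (intro sum.cong refl) (simp only: inner mem_Collect_eq power_one_right)
    \<comment> \<open>The sums of \<open>d ^ 4\<close> from the two diagonals cancel, so only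
      divisor sums with odd exponent remain.\<close>
    finally have "8 * ?c 1 3 = 7 / 10 * ?s 5 + ?s 3 / 3 - ?s 1 / 30 - of_nat n * ?s 3"
      by (simp only: sum.distrib sum_subtractf flip: sum_distrib_left sum_divide_distrib) (simp only: sigma_sum, simp)
    thus "240 * (\<Sum>k = 0..n. of_nat (sigma 1 k) * of_nat (sigma 3 (n - k)))
      = 21 * ?s 5 + 10 * ?s 3 - ?s 1 - 30 * of_nat n * ?s 3"
      unfolding sum_quads_sigma by (simp add: field_simps; algebra)
  }
  show h33: "120 * (\<Sum>k = 0..n. of_nat (sigma 3 k) * of_nat (sigma 3 (n - k))) = ?s 7 - ?s 3"
  proof -
    define h :: "nat \<Rightarrow> nat \<Rightarrow> complex" where "h a b = (of_nat a * of_nat b * (of_nat a + of_nat b)) ^ 2" for a b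
    define g :: "nat \<Rightarrow> nat \<Rightarrow> complex" where "g a b = (of_nat a * of_nat b * (of_nat a - of_nat b)) ^ 2" for a b
    have inner: "(\<Sum>a = 1..<d. h a (d - a)) = of_nat d ^ 7 / 30 - of_nat d ^ 3 / 30"
      if "d dvd n" for d
    proof -
      let ?D = "of_nat d :: complex"
      have "(\<Sum>a = 1..<d. h a (d - a)) = (\<Sum>a = 1..<d. ?D ^ 4 * of_nat a ^ 2
          - 2 * ?D ^ 3 * of_nat a ^ 3 + ?D ^ 2 * of_nat a ^ 4)"
        by (intro sum.cong refl) (simp add: h_def of_nat_diff, algebra)
      also have "\<dots> = ?D ^ 7 / 30 - ?D ^ 3 / 30"
        unfolding drop0[OF that] sum.distrib sum_subtractf
        by (simp add: power_sums flip: sum_distrib_left) (simp add: field_simps; algebra)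
      finally show ?thesis .
    qed
    have "(\<Sum>(a, b, x, y) \<in> quads n. h a b - g a b)
        = (\<Sum>(a, b, x, y) \<in> quads n. 4 * (of_nat a ^ 3 * of_nat b ^ 3))"
      by (intro sum.cong refl) (clarsimp simp: h_def g_def, algebra)
    also have "\<dots> = 4 * ?c 3 3"
      by (simp only: case_prod_unfold sum_distrib_left)
    finally have lhs: "(\<Sum>(a, b, x, y) \<in> quads n. h a b - g a b) = 4 * ?c 3 3" .
    have "4 * ?c 3 3 = (\<Sum>d | d dvd n. \<Sum>a = 1..<d. h a (d - a))
        - (\<Sum>d | d dvd n. of_nat (n div d - 1) * g d d)"
      unfolding lhs[symmetric]
    proof (rule sum_quads_eq_divisor_sums[OF assms])
      show "h a b = h b a" "g a b = g b a" "g (a + b) b = h a b" for a b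
        by (simp only: h_def g_def of_nat_add, algebra)+
    qed
    \<comment> \<open>The factor \<open>a - b\<close> kills \<open>g\<close> on the diagonal, which
      is why this convolution has no term with a factor \<open>n\<close>.\<close>
    also have "(\<Sum>d | d dvd n. of_nat (n div d - 1) * g d d) = 0"
      by (simp add: g_def)
    also have "(\<Sum>d | d dvd n. \<Sum>a = 1..<d. h a (d - a))
       = (\<Sum>d | d dvd n. of_nat d ^ 7 / 30 - of_nat d ^ 3 / 30)"
      by (intro sum.cong refl) (simp only: inner mem_Collect_eq power_one_right)
    finally have "4 * ?c 3 3 = ?s 7 / 30 - ?s 3 / 30"
      by (simp only: sum.distrib sum_subtractf flip: sum_distrib_left sum_divide_distrib) (simp only: sigma_sum, simp)
    thus ?thesis
      unfolding sum_quads_sigma by (simp add: field_simps; algebra)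
  qed
  {
    define h :: "nat \<Rightarrow> nat \<Rightarrow> complex" where "h a b = (of_nat a ^ 2 + of_nat a * of_nat b + of_nat b ^ 2) ^ 3" for a b
    define g :: "nat \<Rightarrow> nat \<Rightarrow> complex" where "g a b = (of_nat a ^ 2 - of_nat a * of_nat b + of_nat b ^ 2) ^ 3" for a b
    have inner: "(\<Sum>a = 1..<d. h a (d - a)) = 83 / 140 * of_nat d ^ 7 - of_nat d ^ 6 + of_nat d ^ 5 / 2
       - 7 / 60 * of_nat d ^ 3 + of_nat d / 42"
      if "d dvd n" for d
    proof -
      let ?D = "of_nat d :: complex"
      have "(\<Sum>a = 1..<d. h a (d - a)) = (\<Sum>a = 1..<d. ?D ^ 6 - 3 * ?D ^ 5 * of_nat a + 6 * ?D ^ 4 * of_nat a ^ 2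
          - 7 * ?D ^ 3 * of_nat a ^ 3 + 6 * ?D ^ 2 * of_nat a ^ 4 - 3 * ?D * of_nat a ^ 5 + of_nat a ^ 6)"
        by (intro sum.cong refl) (simp add: h_def of_nat_diff, algebra)
      also have "\<dots> = 83 / 140 * ?D ^ 7 - ?D ^ 6 + ?D ^ 5 / 2 - 7 / 60 * ?D ^ 3 + ?D / 42"
        unfolding drop0[OF that] sum.distrib sum_subtractf
        by (simp add: power_sums flip: sum_distrib_left) (simp add: field_simps; algebra)
      finally show ?thesis .
    qed
    \<comment> \<open>The cube also produces \<open>a ^ 3 * b ^ 3\<close>; its contribution is
      removed at the end by \<open>h33\<close>.\<close>
    have "(\<Sum>(a, b, x, y) \<in> quads n. h a b - g a b)
        = (\<Sum>(a, b, x, y) \<in> quads n. 6 * (of_nat a ^ 5 * of_nat b ^ 1) + 6 * (of_nat a ^ 1 * of_nat b ^ 5)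
            + 14 * (of_nat a ^ 3 * of_nat b ^ 3))"
      by (intro sum.cong refl) (clarsimp simp: h_def g_def, algebra)
    also have "\<dots> = 6 * ?c 5 1 + 6 * ?c 1 5 + 14 * ?c 3 3"
      by (simp only: case_prod_unfold sum.distrib sum_distrib_left)
    finally have lhs: "(\<Sum>(a, b, x, y) \<in> quads n. h a b - g a b) = 12 * ?c 1 5 + 14 * ?c 3 3"
      using swap[of 1 5] by simp
    have "12 * ?c 1 5 + 14 * ?c 3 3 = (\<Sum>d | d dvd n. \<Sum>a = 1..<d. h a (d - a))
        - (\<Sum>d | d dvd n. of_nat (n div d - 1) * g d d)"
      unfolding lhs[symmetric]
    proof (rule sum_quads_eq_divisor_sums[OF assms])
      show "h a b = h b a" "g a b = g b a" "g (a + b) b = h a b" for a b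
        by (simp only: h_def g_def of_nat_add, algebra)+
    qed
    also have "(\<Sum>d | d dvd n. of_nat (n div d - 1) * g d d)
        = (\<Sum>d | d dvd n. of_nat n * of_nat d ^ 5 - of_nat d ^ 6)"
    proof (intro sum.cong refl)
      fix d assume "d \<in> {d. d dvd n}"
      moreover have "g d d = of_nat d ^ Suc 5" by (simp add: g_def power2_eq_square eval_nat_numeral)
      ultimately show "of_nat (n div d - 1) * g d d = of_nat n * of_nat d ^ 5 - of_nat d ^ 6"
        using codiv[of d 5] by simp
    qed
    also have "(\<Sum>d | d dvd n. \<Sum>a = 1..<d. h a (d - a))
       = (\<Sum>d | d dvd n. 83 / 140 * of_nat d ^ 7 - of_nat d ^ 6 + of_nat d ^ 5 / 2
           - 7 / 60 * of_nat d ^ 3 + of_nat d ^ 1 / 42)"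
      by (intro sum.cong refl) (simp only: inner mem_Collect_eq power_one_right)
    finally have "12 * ?c 1 5 + 14 * ?c 3 3
        = 83 / 140 * ?s 7 + ?s 5 / 2 - 7 / 60 * ?s 3 + ?s 1 / 42 - of_nat n * ?s 5"
      by (simp only: sum.distrib sum_subtractf flip: sum_distrib_left sum_divide_distrib) (simp only: sigma_sum, simp)
    thus "504 * (\<Sum>k = 0..n. of_nat (sigma 1 k) * of_nat (sigma 5 (n - k)))
      = 20 * ?s 7 + 21 * ?s 5 + ?s 1 - 42 * of_nat n * ?s 5"
      using h33 unfolding sum_quads_sigma by (simp add: field_simps; algebra)
  }
qed

subsection \<open>Logarithmic derivative of \<open>j\<close>\<close>

definition sigma_fps :: "nat \<Rightarrow> complex fps" where
  "sigma_fps k = Abs_fps (\<lambda>n. of_nat (sigma k n))"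

lemma sigma_0 [simp]: "sigma k 0 = 0"
  by (simp add: sigma_def)

lemma Eis_conv_sigma_fps:
  "Eis2 = 1 - 24 * sigma_fps 1" "Eis4 = 1 + 240 * sigma_fps 3" "Eis6 = 1 - 504 * sigma_fps 5"
  by (rule fps_ext; simp add: Eis2_def Eis4_def Eis6_def sigma_fps_def numeral_fps_const)+

text \<open>The factor \<open>n\<close> becomes \<open>\<theta>\<close>, and at \<open>n = 0\<close>
  every term vanishes. The second identity amounts to
  \<open>Eis4 ^ 2 = 1 + 480 * sigma_fps 7\<close>.\<close>

lemma sigma_fps_mult:
  "240 * (sigma_fps 1 * sigma_fps 3) = 21 * sigma_fps 5 + 10 * sigma_fps 3 - sigma_fps 1
    - 30 * (fps_X * fps_deriv (sigma_fps 3))" (is ?h13)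
  "120 * sigma_fps 3 ^ 2 = sigma_fps 7 - sigma_fps 3" (is ?h33)
  "504 * (sigma_fps 1 * sigma_fps 5) = 20 * sigma_fps 7 + 21 * sigma_fps 5 + sigma_fps 1
    - 42 * (fps_X * fps_deriv (sigma_fps 5))" (is ?h15)
proof -
  have theta: "(fps_X * fps_deriv (sigma_fps k)) $ n = of_nat n * of_nat (sigma k n)" for k n
    by (cases n) (simp_all add: sigma_fps_def)
  have nth: "sigma_fps k $ n = of_nat (sigma k n)" for k n
    by (simp add: sigma_fps_def)
  have mult: "(sigma_fps i * sigma_fps j) $ n = (\<Sum>k = 0..n. of_nat (sigma i k) * of_nat (sigma j (n - k)))" for i j n
    by (simp add: sigma_fps_def fps_mult_nth)
  show ?h13
  proof (rule fps_ext)
    fix n show "(240 * (sigma_fps 1 * sigma_fps 3)) $ n = (21 * sigma_fps 5 + 10 * sigma_fps 3 - sigma_fps 1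
        - 30 * (fps_X * fps_deriv (sigma_fps 3))) $ n"
      using sigma_convolution_1_3[of n]
      by (cases "n = 0")
         (simp_all only: numeral_fps_const fps_mult_left_const_nth fps_add_nth fps_sub_nth mult nth theta, simp_all)
  qed
  show ?h33
  proof (rule fps_ext)
    fix n show "(120 * sigma_fps 3 ^ 2) $ n = (sigma_fps 7 - sigma_fps 3) $ n"
      using sigma_convolution_3_3[of n] unfolding power2_eq_square
      by (cases "n = 0")
         (simp_all only: numeral_fps_const fps_mult_left_const_nth fps_add_nth fps_sub_nth mult nth theta, simp_all)
  qed
  show ?h15
  proof (rule fps_ext)
    fix n show "(504 * (sigma_fps 1 * sigma_fps 5)) $ n = (20 * sigma_fps 7 + 21 * sigma_fps 5 + sigma_fps 1
        - 42 * (fps_X * fps_deriv (sigma_fps 5))) $ n"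
      using sigma_convolution_1_5[of n]
      by (cases "n = 0")
         (simp_all only: numeral_fps_const fps_mult_left_const_nth fps_add_nth fps_sub_nth mult nth theta, simp_all)
  qed
qed

lemma Ramanujan_Eis4: "3 * (fps_X * fps_deriv Eis4) = Eis2 * Eis4 - Eis6"
proof -
  have "fps_deriv Eis4 = 240 * fps_deriv (sigma_fps 3)"
    by (simp add: Eis_conv_sigma_fps)
  thus ?thesis using sigma_fps_mult(1) unfolding Eis_conv_sigma_fps by algebra
qed

text \<open>The series \<open>sigma_fps 7\<close> is eliminated between the identities for
  \<open>sigma_fps 3 ^ 2\<close> and \<open>sigma_fps 1 * sigma_fps 5\<close>.\<close>

lemma Ramanujan_Eis6: "2 * (fps_X * fps_deriv Eis6) = Eis2 * Eis6 - Eis4 ^ 2"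
proof -
  have "fps_deriv Eis6 = - 504 * fps_deriv (sigma_fps 5)"
    by (simp add: Eis_conv_sigma_fps)
  thus ?thesis using sigma_fps_mult(2,3) unfolding Eis_conv_sigma_fps by algebra
qed

lemma Delta_mult_1728: "1728 * Delta = Eis4 ^ 3 - Eis6 ^ 2"
  by (rule fps_ext) (simp add: Delta_nth numeral_fps_const)

text \<open>This is the logarithmic derivative of \<open>Eis4 ^ 3 / Delta\<close>, cleared of
  denominators. The contributions of \<open>Eis2\<close> in Ramanujan's formulas cancel.\<close>

lemma Delta_deriv:
  "3 * Delta * (fps_X * fps_deriv Eis4) - Eis4 * (fps_X * fps_deriv Delta) = - (Eis6 * Delta)"
proof -
  have "1728 * fps_deriv Delta = fps_deriv (1728 * Delta)" by simp
  also have "\<dots> = 3 * Eis4 ^ 2 * fps_deriv Eis4 - 2 * Eis6 * fps_deriv Eis6"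
    unfolding Delta_mult_1728 by (simp add: fps_deriv_power algebra_simps numeral_fps_const)
  finally have "1728 * (3 * Delta * (fps_X * fps_deriv Eis4) - Eis4 * (fps_X * fps_deriv Delta))
      = 1728 * (- (Eis6 * Delta))"
    using Delta_mult_1728 Ramanujan_Eis4 Ramanujan_Eis6 by algebra
  thus ?thesis by (subst (asm) mult_cancel_left) simp
qed

section \<open>The power series \<open>x j(x)\<close>\<close>

definition Delta_over_X :: "complex fps" where
  "Delta_over_X = fps_shift 1 Delta"

lemma X_mult_Delta_over_X: "fps_X * Delta_over_X = Delta"
  unfolding Delta_over_X_def by (rule fps_ext) simp

lemma Delta_over_X_nth_0 [simp]: "Delta_over_X $ 0 = 1"
  by (simp add: Delta_over_X_def)

text \<open>Removing the pole of \<open>j\<close> keeps the calculations among power series. The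
  coefficient \<open>c\<^sub>m\<close> of \<open>j\<close> is \<open>X_times_j $ Suc m\<close>, and
  \<open>X_times_j $ 0\<close> belongs to the pole.\<close>

definition X_times_j :: "complex fps" where
  "X_times_j = Eis4 ^ 3 / Delta_over_X"

lemma X_times_j_mult_Delta: "X_times_j * Delta_over_X = Eis4 ^ 3"
  unfolding X_times_j_def
  by (simp add: fps_divide_unit mult.assoc inverse_mult_eq_1)

lemma X_times_j_nth_0 [simp]: "X_times_j $ 0 = 1"
  using arg_cong[OF X_times_j_mult_Delta, of "\<lambda>f. f $ 0"] by (simp add: fps_mult_nth power3_eq_cube)

text \<open>With \<open>f = x j\<close> one has \<open>x \<theta>j = \<theta>f - f\<close>, so this
  is \<open>\<theta>j = - j E\<^sub>6 / E\<^sub>4\<close> cleared of denominators.\<close>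

lemma X_times_j_deriv:
  "(fps_X * fps_deriv X_times_j - X_times_j) * Eis4 = - (X_times_j * Eis6)"
proof -
  have D: "fps_deriv Delta = Delta_over_X + fps_X * fps_deriv Delta_over_X"
    by (simp add: flip: X_mult_Delta_over_X)
  have J: "fps_deriv X_times_j * Delta_over_X + X_times_j * fps_deriv Delta_over_X = 3 * Eis4 ^ 2 * fps_deriv Eis4"
    using arg_cong[OF X_times_j_mult_Delta, of fps_deriv]
    by (simp add: fps_deriv_power algebra_simps numeral_fps_const)
  have nz: "Delta_over_X \<noteq> 0" using Delta_over_X_nth_0 by fastforce
  have "fps_X * (3 * Delta_over_X * (fps_X * fps_deriv Eis4) - Eis4 * (Delta_over_X + fps_X * fps_deriv Delta_over_X))
      = fps_X * (- (Eis6 * Delta_over_X))"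
    using Delta_deriv X_mult_Delta_over_X D by algebra
  hence E: "3 * Delta_over_X * (fps_X * fps_deriv Eis4) - Eis4 * (Delta_over_X + fps_X * fps_deriv Delta_over_X)
      = - (Eis6 * Delta_over_X)"
    by (subst (asm) mult_cancel_left) simp
  \<comment> \<open>The extra factor makes the claim a polynomial consequence of \<open>E\<close>,
    \<open>J\<close> and \<open>X_times_j * Delta_over_X = Eis4 ^ 3\<close>.\<close>
  have "Delta_over_X ^ 2 * ((fps_X * fps_deriv X_times_j - X_times_j) * Eis4)
      = Delta_over_X ^ 2 * (- (X_times_j * Eis6))"
    using E J X_times_j_mult_Delta by algebra
  thus ?thesis using nz by (subst (asm) mult_cancel_left) simp
qed

subsection \<open>Multiplication by \<open>j\<close> on the Faber basis\<close>

text \<open>A polynomial of degree \<open>d\<close> in \<open>j\<close> has its leading coefficient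
  at \<open>x ^ (- d)\<close>, so it is zero once all exponents up to 0 vanish.\<close>

lemma eval_j_eqI:
  assumes "\<And>k. k \<le> 0 \<Longrightarrow> eval_j F $$ k = eval_j G $$ k"
  shows "F = G"
proof -
  have "eval_j (F - G) $$ (- int (degree (F - G))) = 0"
    by (simp add: eval_j_diff assms)
  hence "lead_coeff (F - G) = 0" by (simp only: eval_j_nth_degree)
  thus ?thesis by (simp only: leading_coeff_0_iff right_minus_eq)
qed

lemma eval_j_0 [simp]: "eval_j 0 = 0" and eval_j_1 [simp]: "eval_j 1 = 1"
  by (simp_all add: eval_j_def map_poly_1)

lemma eval_j_const: "eval_j [:c:] = fls_const c"
  by (cases "c = 0") (simp_all add: eval_j_def map_poly_pCons)

lemma eval_j_pCons_0: "eval_j (pCons 0 F) = jx * eval_j F"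
  by (simp add: eval_j_def map_poly_pCons)

lemma eval_j_sum: "eval_j (\<Sum>i\<in>A. F i) = (\<Sum>i\<in>A. eval_j (F i))"
  by (induction A rule: infinite_finite_induct) (simp_all add: eval_j_add)

lemma fls_nth_X_inv_power_times: "(fls_X_inv ^ n * f) $$ k = f $$ (k + int n)"
  by (simp add: fls_X_inv_power_times_conv_shift)

lemma fls_nth_X_inv_times: "(fls_X_inv * f) $$ k = f $$ (k + 1)" for f :: "complex fls"
  by (simp add: fls_X_inv_times_conv_shift)

lemma fls_nth_X_times: "(fls_X * f) $$ k = f $$ (k - 1)" for f :: "complex fls"
  by (simp add: fls_X_times_conv_shift)

lemma fls_X_inv_mult_X: "fls_X_inv * fls_X = (1 :: complex fls)"
  by (simp add: fls_X_inv_times_conv_shift)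

lemma jx_conv_X_times_j: "jx = fls_X_inv * fps_to_fls X_times_j"
proof -
  have "fls_X_inv * fps_to_fls X_times_j * fps_to_fls Delta
      = (fls_X_inv * fls_X) * fps_to_fls (X_times_j * Delta_over_X)"
    by (simp add: fls_times_fps_to_fls flip: X_mult_Delta_over_X)
  also have "\<dots> = jx * fps_to_fls Delta"
    by (simp only: fls_X_inv_mult_X X_times_j_mult_Delta jx_mult_Delta mult_1_left)
  finally show ?thesis by simp
qed

lemma jx_nth: "jx $$ int n = X_times_j $ Suc n"
  by (simp add: jx_conv_X_times_j fls_nth_X_inv_times nat_add_distrib)

lemma fls_deriv_jx:
  "fls_deriv jx = fls_X_inv ^ 2 * fps_to_fls (fps_X * fps_deriv X_times_j - X_times_j)"
proof (rule fls_eqI)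
  fix k :: int
  let ?K = "fps_X * fps_deriv X_times_j - X_times_j"
  have K: "?K $ m = (of_nat m - 1) * X_times_j $ m" for m
    by (cases m) (simp_all add: algebra_simps)
  have "jx $$ (k + 1) = fps_to_fls X_times_j $$ (k + 2)"
    by (simp add: jx_conv_X_times_j fls_nth_X_inv_times add.commute)
  thus "fls_deriv jx $$ k = (fls_X_inv ^ 2 * fps_to_fls ?K) $$ k"
    unfolding fls_nth_X_inv_power_times fls_deriv_nth fps_to_fls_nth K
    by (auto simp: add.commute)
qed

section \<open>Expansion of \<open>F\<^sub>n(j)\<close> and of its product with
  \<open>j\<close>\<close>

definition faber_tail :: "nat \<Rightarrow> complex fps" where
  "faber_tail n = Abs_fps (\<lambda>m. eval_j (faber n) $$ (int m + 1))"

lemma eval_j_faber_nth: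
  assumes "k \<le> 0"
  shows "eval_j (faber n) $$ k = (if k = - int n then 1 else 0)"
proof -
  have "(eval_j (faber n) - fls_X_inv ^ n) $$ k = 0"
    using is_faber_faber[of n] assms unfolding is_faber_def by blast
  thus ?thesis by (simp only: fls_minus_nth right_minus_eq fls_X_inv_power_nth)
qed

lemma eval_j_faber: "eval_j (faber n) = fls_X_inv ^ n + fls_X * fps_to_fls (faber_tail n)"
proof (rule fls_eqI)
  fix k :: int
  show "eval_j (faber n) $$ k = (fls_X_inv ^ n + fls_X * fps_to_fls (faber_tail n)) $$ k"
  proof (cases "k \<le> 0")
    case True
    thus ?thesis by (simp add: eval_j_faber_nth fls_nth_X_times)
  next
    case False
    thus ?thesis by (simp add: fls_nth_X_times faber_tail_def)
  qed
qed

lemma faber_0 [simp]: "faber 0 = 1"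
  by (rule eval_j_eqI) (simp add: eval_j_faber_nth)

text \<open>A polynomial in \<open>j\<close> times \<open>dj\<close> is exact, so it has no residue.\<close>

lemma residue_eval_j_deriv: "(eval_j F * fls_deriv jx) $$ (- 1) = 0"
proof -
  have "(jx ^ i * fls_deriv jx) $$ (- 1) = 0" for i
  proof -
    have "fls_const (of_nat (Suc i)) * (jx ^ i * fls_deriv jx) = fls_deriv (jx ^ Suc i)"
      by (simp only: fls_deriv_power diff_Suc_1 fls_of_nat mult.assoc)
    hence "of_nat (Suc i) * (jx ^ i * fls_deriv jx) $$ (- 1) = fls_deriv (jx ^ Suc i) $$ (- 1)"
      by (metis fls_mult_const_nth(1))
    thus ?thesis unfolding fls_deriv_residue by (simp del: of_nat_Suc)
  qed
  thus ?thesis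
    by (simp add: eval_j_altdef sum_distrib_right fls_nth_sum mult.assoc)
qed

text \<open>In the vanishing residue of \<open>F\<^sub>n(j) dj\<close>, the part
  \<open>x ^ (- n)\<close> contributes \<open>n c\<^sub>n\<close>, and the tail meets the double
  pole of \<open>dj\<close>, contributing minus the coefficient of \<open>x\<close>.\<close>

lemma faber_tail_nth_0: "faber_tail n $ 0 = of_nat n * X_times_j $ Suc n"
proof -
  let ?K = "fps_X * fps_deriv X_times_j - X_times_j"
  have "fls_X * fps_to_fls (faber_tail n) * fls_deriv jx
      = (fls_X_inv * fls_X) * (fls_X_inv * fps_to_fls (faber_tail n * ?K))"
    by (simp only: fls_deriv_jx fls_times_fps_to_fls power2_eq_square mult_ac)
  hence "(fls_X * fps_to_fls (faber_tail n) * fls_deriv jx) $$ (- 1) = - faber_tail n $ 0"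
    by (simp add: fls_X_inv_mult_X fls_nth_X_inv_times del: fls_deriv_nth)
  moreover have "(fls_X_inv ^ n * fls_deriv jx) $$ (- 1) = of_nat n * X_times_j $ Suc n"
    by (simp add: fls_nth_X_inv_power_times jx_nth)
  ultimately show ?thesis
    using residue_eval_j_deriv[of "faber n"] by (simp add: eval_j_faber distrib_right del: fls_deriv_nth)
qed

text \<open>Both sides are polynomials in \<open>j\<close>, so it suffices to compare exponents up
  to 0.\<close>

lemma jx_mult_faber:
  "jx * eval_j (faber n) = eval_j (faber (Suc n))
     + (\<Sum>m\<le>n. fls_const (X_times_j $ Suc m) * eval_j (faber (n - m)))
     + fls_const (of_nat n * X_times_j $ Suc n)"
proof -
  define R where "R = faber (Suc n) + (\<Sum>m\<le>n. smult (X_times_j $ Suc m) (faber (n - m)))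
     + [:of_nat n * X_times_j $ Suc n:]"
  have R: "eval_j R = eval_j (faber (Suc n))
     + (\<Sum>m\<le>n. fls_const (X_times_j $ Suc m) * eval_j (faber (n - m)))
     + fls_const (of_nat n * X_times_j $ Suc n)"
    by (simp add: R_def eval_j_add eval_j_sum eval_j_smult eval_j_const)
  have "pCons 0 (faber n) = R"
  proof (rule eval_j_eqI)
    fix k :: int assume k: "k \<le> 0"
    \<comment> \<open>The pole of \<open>j\<close> cancels the factor \<open>x\<close> in front of
      the tail. Among exponents up to 0 the tail therefore enters only at 0, with the value
      \<open>n c\<^sub>n\<close>.\<close>
    have "jx * eval_j (faber n) = fls_X_inv ^ Suc n * fps_to_fls X_times_j
        + (fls_X_inv * fls_X) * fps_to_fls (X_times_j * faber_tail n)"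
      by (simp add: jx_conv_X_times_j eval_j_faber fls_times_fps_to_fls algebra_simps)
    hence "eval_j (pCons 0 (faber n)) $$ k = fps_to_fls X_times_j $$ (k + int (Suc n))
        + (if k = 0 then of_nat n * X_times_j $ Suc n else 0)"
      using k by (simp add: eval_j_pCons_0 fls_X_inv_mult_X fls_nth_X_inv_power_times faber_tail_nth_0 del: power_Suc)
    \<comment> \<open>Only \<open>m = k + n\<close> contributes at exponent \<open>k\<close>. The
      remaining exponent \<open>- n - 1\<close> is supplied by \<open>faber (Suc n)\<close>.\<close>
    moreover have "(\<Sum>m\<le>n. X_times_j $ Suc m * eval_j (faber (n - m)) $$ k)
        = (if - int n \<le> k then X_times_j $ nat (k + int (Suc n)) else 0)"
    proof -
      have "(\<Sum>m\<le>n. X_times_j $ Suc m * eval_j (faber (n - m)) $$ k)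
          = (\<Sum>m\<le>n. if int m = k + int n then X_times_j $ Suc m else 0)"
        using k by (intro sum.cong refl) (auto simp: eval_j_faber_nth of_nat_diff)
      also have "\<dots> = (if - int n \<le> k then X_times_j $ nat (k + int (Suc n)) else 0)"
      proof (cases "- int n \<le> k")
        case True
        then obtain i where i: "k + int n = int i" using nonneg_int_cases[of "k + int n"] by auto
        have "nat (k + int (Suc n)) = Suc i" "i \<le> n" using i k by auto
        thus ?thesis using True i by (simp del: of_nat_Suc)
      qed auto
      finally show ?thesis .
    qed
    moreover have "eval_j R $$ k = (if k = - int (Suc n) then 1 else 0)
       + (\<Sum>m\<le>n. X_times_j $ Suc m * eval_j (faber (n - m)) $$ k)
       + (if k = 0 then of_nat n * X_times_j $ Suc n else 0)"
      using k by (simp add: R fls_nth_sum eval_j_faber_nth[of _ "Suc n"])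
    ultimately show "eval_j (pCons 0 (faber n)) $$ k = eval_j R $$ k"
      by auto
  qed
  thus ?thesis using R eval_j_pCons_0 by metis
qed

section \<open>The Atkin pairing on the Faber basis\<close>

lemma atkin_commute: "atkin f g = atkin g f"
  by (simp add: atkin_def mult.commute)

text \<open>The \<open>O(x)\<close> part of \<open>F\<^sub>l(j)\<close> does not reach the constant
  term, so \<open>x ^ (- l)\<close> picks out one coefficient of \<open>Eis2\<close>.\<close>

lemma eval_j_faber_mult_Eis2_nth_0: "(eval_j (faber l) * fps_to_fls Eis2) $$ 0 = Eis2 $ l"
  by (simp add: eval_j_faber distrib_right mult.assoc fls_nth_X_inv_power_times fls_nth_X_times
        flip: fls_times_fps_to_fls)

lemma atkin_faber_0: "atkin (faber 0) (faber l) = Eis2 $ l"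
  by (simp add: atkin_def eval_j_faber_mult_Eis2_nth_0)

lemma atkin_jx_mult:
  "(jx * eval_j (faber n) * eval_j (faber l) * fps_to_fls Eis2) $$ 0
    = atkin (faber (Suc n)) (faber l)
      + (\<Sum>m\<le>n. X_times_j $ Suc m * atkin (faber (n - m)) (faber l))
      + of_nat n * X_times_j $ Suc n * Eis2 $ l"
  unfolding jx_mult_faber
  by (simp add: distrib_right sum_distrib_right fls_nth_sum atkin_def mult.assoc
        eval_j_faber_mult_Eis2_nth_0)

text \<open>Both sides are \<open>(j F\<^sub>n, F\<^sub>l) = (F\<^sub>n, j F\<^sub>l)\<close>.\<close>

lemma atkin_faber_recurrence:
  "atkin (faber (Suc n)) (faber l)
      + (\<Sum>m\<le>n. X_times_j $ Suc m * atkin (faber (n - m)) (faber l))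
      + of_nat n * X_times_j $ Suc n * Eis2 $ l
    = atkin (faber n) (faber (Suc l))
      + (\<Sum>m\<le>l. X_times_j $ Suc m * atkin (faber n) (faber (l - m)))
      + of_nat l * X_times_j $ Suc l * Eis2 $ n"
  using atkin_jx_mult[of n l] atkin_jx_mult[of l n]
  by (simp add: mult_ac atkin_commute[of _ "faber n"])

subsection \<open>Integrality\<close>

definition integral_fps :: "complex fps \<Rightarrow> bool" where
  "integral_fps f \<longleftrightarrow> (\<forall>n. f $ n \<in> \<int>)"

lemma integral_fps_add: "integral_fps f \<Longrightarrow> integral_fps g \<Longrightarrow> integral_fps (f + g)"
  and integral_fps_diff: "integral_fps f \<Longrightarrow> integral_fps g \<Longrightarrow> integral_fps (f - g)"
  by (simp_all add: integral_fps_def)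

lemma integral_fps_mult: "integral_fps f \<Longrightarrow> integral_fps g \<Longrightarrow> integral_fps (f * g)"
  by (auto simp: integral_fps_def fps_mult_nth intro!: Ints_sum Ints_mult)

lemma integral_fps_numeral: "integral_fps (numeral k)" and integral_fps_1: "integral_fps 1"
  by (simp_all add: integral_fps_def fps_numeral_nth)

lemma integral_fps_power: "integral_fps f \<Longrightarrow> integral_fps (f ^ n)"
  by (induction n) (auto intro: integral_fps_mult simp: integral_fps_1)

lemma integral_sigma_fps: "integral_fps (sigma_fps k)"
  by (simp add: integral_fps_def sigma_fps_def)

lemmas integral_fps_intros = integral_fps_add integral_fps_diff integral_fps_mult integral_fps_power
  integral_fps_numeral integral_fps_1 integral_sigma_fps

lemma integral_Eis2: "integral_fps Eis2" and integral_Eis4: "integral_fps Eis4"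
  unfolding Eis_conv_sigma_fps by (intro integral_fps_intros)+

text \<open>The congruence behind the integrality of \<open>Delta\<close>; it depends only on
  \<open>d\<close> modulo 12.\<close>

lemma twelve_dvd: "12 dvd 5 * d ^ 3 + 7 * d ^ 5" for d :: nat
proof -
  have "\<forall>r\<in>{..<12 :: nat}. (5 * r ^ 3 + 7 * r ^ 5) mod 12 = 0"
    by (simp add: lessThan_nat_numeral)
  moreover have "d mod 12 \<in> {..<12}" by simp
  ultimately have "(5 * (d mod 12) ^ 3 + 7 * (d mod 12) ^ 5) mod 12 = 0" by blast
  moreover have "(5 * d ^ 3 + 7 * d ^ 5) mod 12 = (5 * (d mod 12) ^ 3 + 7 * (d mod 12) ^ 5) mod 12"
    by (intro mod_add_cong mod_mult_cong refl power_mod[symmetric])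
  ultimately show ?thesis by auto
qed

text \<open>In \<open>Eis4 ^ 3 - Eis6 ^ 2\<close> the nonlinear terms in \<open>A\<close>,
  \<open>B\<close> have coefficients divisible by 1728. The linear part is
  \<open>144 * (5 * A + 7 * B)\<close>, and \<open>C\<close> is its division by 1728, carried out
  divisor by divisor.\<close>

lemma integral_Delta: "integral_fps Delta"
proof -
  define A where "A = sigma_fps 3"
  define B where "B = sigma_fps 5"
  define C :: "complex fps" where "C = Abs_fps (\<lambda>n. of_nat (\<Sum>d | d dvd n. (5 * d ^ 3 + 7 * d ^ 5) div 12))"
  have C: "12 * C = 5 * A + 7 * B"
  proof (rule fps_ext)
    fix n
    have "12 * (\<Sum>d | d dvd n. (5 * d ^ 3 + 7 * d ^ 5) div 12) = 5 * sigma 3 n + 7 * sigma 5 n"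
      by (simp add: sigma_def sum_distrib_left dvd_mult_div_cancel[OF twelve_dvd] flip: sum.distrib)
    from arg_cong[OF this, of "of_nat :: nat \<Rightarrow> complex"]
    show "(12 * C) $ n = (5 * A + 7 * B) $ n"
      by (simp add: C_def A_def B_def sigma_fps_def numeral_fps_const)
  qed
  have "1728 * Delta = 1728 * (C + 100 * A ^ 2 + 8000 * A ^ 3 - 147 * B ^ 2)"
    using C Delta_mult_1728 unfolding Eis_conv_sigma_fps A_def[symmetric] B_def[symmetric]
    by algebra
  hence "Delta = C + 100 * A ^ 2 + 8000 * A ^ 3 - 147 * B ^ 2"
    by (subst (asm) mult_cancel_left) simp
  moreover have "integral_fps C" unfolding integral_fps_def C_def by (simp del: of_nat_sum)
  hence "integral_fps (C + 100 * A ^ 2 + 8000 * A ^ 3 - 147 * B ^ 2)"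
    unfolding A_def B_def by (intro integral_fps_intros)
  ultimately show ?thesis by (rule ssubst)
qed

text \<open>Since \<open>Delta_over_X\<close> has constant term 1, dividing \<open>Eis4 ^ 3\<close>
  by it is a recursion over the integers.\<close>

lemma integral_X_times_j: "integral_fps X_times_j"
  unfolding integral_fps_def
proof
  fix n show "X_times_j $ n \<in> \<int>"
  proof (induction n rule: less_induct)
    case (less n)
    have D: "Delta_over_X $ i \<in> \<int>" for i
      using integral_Delta by (simp add: Delta_over_X_def integral_fps_def)
    have "(Eis4 ^ 3) $ n = (\<Sum>i = 0..n. X_times_j $ i * Delta_over_X $ (n - i))"
      by (simp add: fps_mult_nth flip: X_times_j_mult_Delta)
    also have "\<dots> = (\<Sum>i<n. X_times_j $ i * Delta_over_X $ (n - i)) + X_times_j $ n"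
      by (simp add: atLeast0AtMost flip: lessThan_Suc_atMost)
    finally have "X_times_j $ n = (Eis4 ^ 3) $ n - (\<Sum>i<n. X_times_j $ i * Delta_over_X $ (n - i))"
      by simp
    moreover have "(Eis4 ^ 3) $ n \<in> \<int>"
      using integral_fps_power[OF integral_Eis4] by (simp add: integral_fps_def)
    ultimately show ?case
      using less D by (auto intro!: Ints_diff Ints_sum Ints_mult)
  qed
qed

text \<open>The recurrence lowers the first index while raising the second, hence the induction on
  \<open>n\<close> for all \<open>l\<close> at once.\<close>

lemma atkin_faber_in_Ints: "atkin (faber n) (faber l) \<in> \<int>"
proof (induction n arbitrary: l rule: less_induct)
  case (less n)
  have J: "X_times_j $ i \<in> \<int>" and E: "Eis2 $ i \<in> \<int>" for i
    using integral_X_times_j integral_Eis2 by (simp_all add: integral_fps_def)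
  show ?case
  proof (cases n)
    case 0
    thus ?thesis using E by (simp only: atkin_faber_0)
  next
    case (Suc k)
    have "atkin (faber n) (faber l) = atkin (faber k) (faber (Suc l))
      + (\<Sum>m\<le>l. X_times_j $ Suc m * atkin (faber k) (faber (l - m)))
      + of_nat l * X_times_j $ Suc l * Eis2 $ k
      - (\<Sum>m\<le>k. X_times_j $ Suc m * atkin (faber (k - m)) (faber l))
      - of_nat k * X_times_j $ Suc k * Eis2 $ l"
      using atkin_faber_recurrence[of k l] Suc by (simp add: algebra_simps)
    also have "\<dots> \<in> \<int>"
      using less Suc J E by (intro Ints_add Ints_diff Ints_mult Ints_sum Ints_of_nat) auto
    finally show ?thesis .
  qed
qed

subsection \<open>The generating function\<close>

text \<open>The series behind \<open>in_p\<close> before passage to fractions, where coefficients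
  can still be compared.\<close>

definition fps_in_p :: "complex fps \<Rightarrow> complex fps fps" where
  "fps_in_p f = Abs_fps (\<lambda>n. fps_const (f $ n))"

lemma fps_in_p_nth [simp]: "fps_in_p f $ n = fps_const (f $ n)"
  by (simp add: fps_in_p_def)

lemma fps_in_p_mult: "fps_in_p (f * g) = fps_in_p f * fps_in_p g"
  by (intro fps_ext) (simp add: fps_mult_nth fps_sum_nth)

lemma fps_in_p_X: "fps_in_p fps_X = fps_X"
  by (rule fps_ext) (simp add: fps_X_def)

lemma in_p_mult: "in_p (f * g) = in_p f * in_p g"
  using arg_cong[OF fps_in_p_mult, of to_fract f g] by (simp add: in_p_def fps_in_p_def)

lemma in_q_mult: "in_q (f * g) = in_q f * in_q g"
  by (simp add: in_q_def flip: to_fract_mult fps_const_mult)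

lemma in_p_uminus: "in_p (- f) = - in_p f"
proof -
  have "Abs_fps (\<lambda>n. fps_const ((- f) $ n)) = - Abs_fps (\<lambda>n. fps_const (f $ n))"
    by (rule fps_ext) simp
  thus ?thesis by (simp add: in_p_def)
qed

lemma in_q_uminus: "in_q (- f) = - in_q f"
  by (simp add: in_q_def flip: to_fract_uminus fps_const_neg)

definition atkin_fps :: "complex fps fps" where
  "atkin_fps = Abs_fps (\<lambda>n. Abs_fps (\<lambda>l. atkin (faber n) (faber l)))"

text \<open>
  Multiplied by \<open>p q\<close> so that no negative exponents occur, this is
  \<open>(j(p) - j(q)) G = E\<^sub>2(p) \<theta>j(q) - E\<^sub>2(q) \<theta>j(p)\<close> with \<open>\<theta> = x d/dx\<close>.
\<close>

lemma atkin_fps_eq: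
  defines "K \<equiv> fps_X * fps_deriv X_times_j - X_times_j"
  shows "(fps_const fps_X * fps_in_p X_times_j - fps_in_p fps_X * fps_const X_times_j) * atkin_fps
    = fps_in_p fps_X * fps_const K * fps_in_p Eis2 - fps_const fps_X * fps_in_p K * fps_const Eis2"
    (is "?lhs = ?rhs")
proof (intro fps_ext)
  fix n l
  let ?c = "\<lambda>n l. atkin (faber n) (faber l)"
  have K: "K $ m = (of_nat m - 1) * X_times_j $ m" for m
    unfolding K_def by (cases m) (simp_all add: algebra_simps)
  have c: "atkin_fps $ n $ l = ?c n l" for n l
    by (simp add: atkin_fps_def)
  have 1: "(fps_in_p X_times_j * atkin_fps) $ n $ l = (\<Sum>m\<le>n. X_times_j $ m * ?c (n - m) l)" for n l
    by (simp add: fps_mult_nth[of "fps_in_p X_times_j"] fps_sum_nth c atLeast0AtMost)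
  have 2: "(X_times_j * atkin_fps $ n) $ l = (\<Sum>m\<le>l. X_times_j $ m * ?c n (l - m))" for n l
    by (simp add: fps_mult_nth[of X_times_j] c atLeast0AtMost)
  have L: "?lhs $ n $ l = (if l = 0 then 0 else \<Sum>m\<le>n. X_times_j $ m * ?c (n - m) (l - 1))
      - (if n = 0 then 0 else \<Sum>m\<le>l. X_times_j $ m * ?c (n - 1) (l - m))"
    unfolding left_diff_distrib mult.assoc fps_in_p_X
    by (simp add: 1 2 c del: faber_0)
  have R: "?rhs $ n $ l = (if n = 0 then 0 else K $ l * Eis2 $ (n - 1))
      - (if l = 0 then 0 else K $ n * Eis2 $ (l - 1))"
    unfolding mult.assoc fps_in_p_X by simp
  have atkin_faber_0': "?c m 0 = Eis2 $ m" for m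
    by (subst atkin_commute) (rule atkin_faber_0)
  \<comment> \<open>Splitting off \<open>m = 0\<close>, the pole of \<open>j\<close>, turns this
    into the recurrence for the pairing.\<close>
  have interior: "(\<Sum>m\<le>Suc a. X_times_j $ m * ?c (Suc a - m) b) - (\<Sum>m\<le>Suc b. X_times_j $ m * ?c a (Suc b - m))
      = (of_nat (Suc b) - 1) * X_times_j $ Suc b * Eis2 $ a - (of_nat (Suc a) - 1) * X_times_j $ Suc a * Eis2 $ b"
    for a b
  proof -
    have "u - v = y - x" if "u + x = v + y" for u v x y :: complex
      using that by (simp add: algebra_simps)
    from this[OF atkin_faber_recurrence[of a b]] show ?thesis
      by (simp only: sum.atMost_Suc_shift diff_Suc_Suc diff_zero X_times_j_nth_0 of_nat_Suc
            mult_1_left add_diff_cancel_left')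
  qed
  show "?lhs $ n $ l = ?rhs $ n $ l"
  proof (cases "n = 0 \<or> l = 0")
    \<comment> \<open>If exactly one index is 0, only the pole contributes, through
      \<open>X_times_j $ 0 = 1\<close> and \<open>K $ 0 = - 1\<close>, and the claim reduces to
      \<open>atkin_faber_0\<close>. If both are 0, both sides vanish.\<close>
    case True
    thus ?thesis unfolding L R K
      by (auto simp: atkin_faber_0 atkin_faber_0' simp del: faber_0)
  next
    case False
    then obtain a b where "n = Suc a" "l = Suc b" by (auto simp: gr0_conv_Suc)
    thus ?thesis unfolding L R K
      using interior[of a b] by (simp only: nat.distinct if_False diff_Suc_1)
  qed
qed

theorem theorem5p5:
  shows "(\<forall>n l. atkin (faber n) (faber l) \<in> \<int>) \<and>
    to_fract (Abs_fps (\<lambda>n. Abs_fps (\<lambda>l. atkin (faber n) (faber l))))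
      = (psi in_p in_q - psi in_q in_p) / (inverse (klein_j in_p) - inverse (klein_j in_q))"
proof (intro conjI allI)
  define K where "K = fps_X * fps_deriv X_times_j - X_times_j"
  define G where "G = to_fract atkin_fps"
  have K: "K * Eis4 = - (X_times_j * Eis6)"
    unfolding K_def by (rule X_times_j_deriv)
  have nz: "X_times_j \<noteq> 0" "Delta_over_X \<noteq> 0"
    using X_times_j_nth_0 Delta_over_X_nth_0 by fastforce+
  have jp: "inverse (klein_j in_p) = in_p fps_X / in_p X_times_j"
  proof -
    have "in_p Eis4 ^ 3 = in_p X_times_j * in_p Delta_over_X"
      by (simp add: power3_eq_cube X_times_j_mult_Delta flip: in_p_mult)
    moreover have "in_p Delta = in_p fps_X * in_p Delta_over_X"
      by (simp add: X_mult_Delta_over_X flip: in_p_mult)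
    ultimately show ?thesis using nz by (simp add: klein_j_def)
  qed
  have jq: "inverse (klein_j in_q) = in_q fps_X / in_q X_times_j"
  proof -
    have "in_q Eis4 ^ 3 = in_q X_times_j * in_q Delta_over_X"
      by (simp add: power3_eq_cube X_times_j_mult_Delta flip: in_q_mult)
    moreover have "in_q Delta = in_q fps_X * in_q Delta_over_X"
      by (simp add: X_mult_Delta_over_X flip: in_q_mult)
    ultimately show ?thesis using nz by (simp add: klein_j_def)
  qed
  have Kp: "in_p Eis6 = - (in_p K * in_p Eis4) / in_p X_times_j"
    using arg_cong[OF K, of in_p] nz by (simp add: in_p_mult in_p_uminus)
  have Kq: "in_q Eis6 = - (in_q K * in_q Eis4) / in_q X_times_j"
    using arg_cong[OF K, of in_q] nz by (simp add: in_q_mult in_q_uminus)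
  have "(in_q fps_X * in_p X_times_j - in_p fps_X * in_q X_times_j) * G
      = in_p fps_X * in_q K * in_p Eis2 - in_q fps_X * in_p K * in_q Eis2"
    using arg_cong[OF atkin_fps_eq, of to_fract]
    by (simp add: in_p_def in_q_def G_def fps_in_p_def K_def)
  \<comment> \<open>By \<open>Kq\<close>, \<open>psi in_p in_q\<close> is
    \<open>- E\<^sub>2(p) \<theta>j(q) / (j(p) j(q))\<close>, and by \<open>Kp\<close> likewise with
    \<open>p\<close> and \<open>q\<close> exchanged. The claim is thus the functional equation of
    \<open>G\<close> divided by \<open>- j(p) j(q)\<close>.\<close>
  hence "G * (inverse (klein_j in_p) - inverse (klein_j in_q)) = psi in_p in_q - psi in_q in_p"
    using nz unfolding psi_def divide_inverse[of _ "klein_j _ * _"] inverse_mult_distrib jp jq Kp Kq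
    by (simp add: field_simps)
  thus "to_fract (Abs_fps (\<lambda>n. Abs_fps (\<lambda>l. atkin (faber n) (faber l))))
      = (psi in_p in_q - psi in_q in_p) / (inverse (klein_j in_p) - inverse (klein_j in_q))"
    using denominator_nonzero by (simp add: eq_divide_eq G_def atkin_fps_def)
qed (rule atkin_faber_in_Ints)

end
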